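(* Let $X$ be a Hilbert space, let $(X_n)_{n\in\mathbb{N}}$ be a sequence of finite dimensional Hilbert spaces, and let $p_n\in L(X,X_n)$, $n\in\mathbb{N}$, satisfy $\lim_{n\to\infty}\|p_nu\|_{X_n}=\|u\|_X$ for each $u\in X$. Let sequences $(A_n)_{n\in\mathbb{N}}$, $(T_n)_{n\in\mathbb{N}}$, $(B_n)_{n\in\mathbb{N}}$, $(K_n)_{n\in\mathbb{N}}$ and operators $B,T\in L(X)$ satisfy the following: there exists a constant $C>0$ such that for each $n\in\mathbb{N}$ it holds $A_n,T_n,B_n,K_n\in L(X_n)$, $T_n$ and $B_n$ are invertible, and $\|T_n\|_{L(X_n)},\|T_n^{-1}\|_{L(X_n)},\|B_n\|_{L(X_n)},\|B_n^{-1}\|_{L(X_n)}\le C$; $B$ is bijective; the sequence $(K_n)_{n\in\mathbb{N}}$ is compact; for all $u\in X$ $$\lim_{n\to\infty}\|T_np_nu-p_nTu\|_{X_n}=0,\qquad \lim_{n\to\infty}\|B_np_nu-p_nBu\|_{X_n}=0;$$ and $A_nT_n=B_n+K_n$ for each $n\in\mathbb{N}$. Then $(A_n)_{n\in\mathbb{N}}$ is regular.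
   Context: $L(X,Y)$ denotes the bounded linear operators from $X$ to $Y$, and $L(X):=L(X,X)$. The spaces $X_n$ need not be subspaces of $X$. Definitions (with respect to $X$, $(X_n)$, $(p_n)$): - A sequence $(u_n)_{n}$, $u_n\in X_n$ (indexed by $\mathbb{N}$ or by an infinite subset of $\mathbb{N}$), converges to $u\in X$ if $\lim_{n\to\infty}\|p_nu-u_n\|_{X_n}=0$. - A sequence $(u_n)_{n\in\mathbb{N}}$, $u_n\in X_n$, is compact if for every infinite $\mathbb{N}'\subset\mathbb{N}$ there exists an infinite $\mathbb{N}''\subset\mathbb{N}'$ such that $(u_n)_{n\in\mathbb{N}''}$ converges to some $u\in X$. - A sequence of operators $(K_n)_{n\in\mathbb{N}}$, $K_n\in L(X_n)$, is compact if for every bounded sequence $(u_n)_{n\in\mathbb{N}}$, $u_n\in X_n$, $\|u_n\|_{X_n}\le C'$, the sequence $(K_nu_n)_{n\in\mathbb{N}}$ is compact. - A sequence of operators $(A_n)_{n\in\mathbb{N}}$, $A_n\in L(X_n)$, is regular if for every bounded sequence $(u_n)_{n\in\mathbb{N}}$, $u_n\in X_n$, $\|u_n\|_{X_n}\le C'$, the compactness of $(A_nu_n)_{n\in\mathbb{N}}$ implies the compactness of $(u_n)_{n\in\mathbb{N}}$. *)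

theory Defs
  imports "HOL-Analysis.Analysis" "HOL-Algebra.Module"
begin

text \<open>
  The spaces \<open>X\<^sub>n\<close> are unrelated to each other and their dimensions vary with \<open>n\<close>, so Hilbert
  spaces are represented by records with explicit carriers instead of by types.  The scalars
  form a set \<open>K\<close> of complex numbers, which is either \<open>\<real>\<close> or all of the complex
  plane; thus real and complex Hilbert spaces are treated at once.
\<close>

definition scalar_ring :: "complex set \<Rightarrow> complex ring" where
  "scalar_ring K = \<lparr>carrier = K, mult = (*), one = 1, zero = 0, add = (+)\<rparr>"

text \<open>The library's module record extends the ring record; its fields \<open>mult\<close> and \<open>one\<close> are
  unconstrained and never used below.\<close>

record 'v ip_space = "(complex, 'v) module" +
  ip :: "'v \<Rightarrow> 'v \<Rightarrow> complex"

definition ip_norm :: "'v ip_space \<Rightarrow> 'v \<Rightarrow> real" where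
  "ip_norm V x = sqrt (Re (ip V x x))"

text \<open>Positivity can be stated for the real part, since \<open>ip_cnj\<close> makes \<open>ip V x x\<close> real.\<close>

locale inner_product_space = module "scalar_ring K" V
  for K :: "complex set" and V :: "'v ip_space" (structure) +
  assumes scalars: "K = \<real> \<or> K = UNIV"
    and ip_closed: "\<lbrakk>x \<in> carrier V; y \<in> carrier V\<rbrakk> \<Longrightarrow> ip V x y \<in> K"
    and ip_cnj: "\<lbrakk>x \<in> carrier V; y \<in> carrier V\<rbrakk> \<Longrightarrow> ip V y x = cnj (ip V x y)"
    and ip_add_left:
      "\<lbrakk>x \<in> carrier V; y \<in> carrier V; z \<in> carrier V\<rbrakk> \<Longrightarrow>
        ip V (x \<oplus>\<^bsub>V\<^esub> y) z = ip V x z + ip V y z"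
    and ip_smult_left:
      "\<lbrakk>c \<in> K; x \<in> carrier V; y \<in> carrier V\<rbrakk> \<Longrightarrow> ip V (c \<odot>\<^bsub>V\<^esub> x) y = c * ip V x y"
    and ip_pos: "\<lbrakk>x \<in> carrier V; x \<noteq> \<zero>\<^bsub>V\<^esub>\<rbrakk> \<Longrightarrow> 0 < Re (ip V x x)"

locale hilbert_space = inner_product_space +
  assumes complete: "Metric_space.mcomplete (carrier V) (\<lambda>x y. ip_norm V (x \<ominus>\<^bsub>V\<^esub> y))"

definition finite_dimensional :: "complex set \<Rightarrow> 'v ip_space \<Rightarrow> bool" where
  "finite_dimensional K V \<longleftrightarrow>
    (\<exists>S. finite S \<and> S \<subseteq> carrier V \<and>
      (\<forall>x\<in>carrier V. \<exists>c\<in>S \<rightarrow> K. x = (\<Oplus>\<^bsub>V\<^esub>s\<in>S. c s \<odot>\<^bsub>V\<^esub> s)))"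

text \<open>Operators are functions on the element types of which only the values on the carrier matter.\<close>

definition bounded_ops :: "complex set \<Rightarrow> 'v ip_space \<Rightarrow> 'w ip_space \<Rightarrow> ('v \<Rightarrow> 'w) set" where
  "bounded_ops K V W =
    {f \<in> carrier V \<rightarrow> carrier W.
      (\<forall>x\<in>carrier V. \<forall>y\<in>carrier V. f (x \<oplus>\<^bsub>V\<^esub> y) = f x \<oplus>\<^bsub>W\<^esub> f y) \<and>
      (\<forall>c\<in>K. \<forall>x\<in>carrier V. f (c \<odot>\<^bsub>V\<^esub> x) = c \<odot>\<^bsub>W\<^esub> f x) \<and>
      (\<exists>M. \<forall>x\<in>carrier V. ip_norm W (f x) \<le> M * ip_norm V x)}"

definition op_norm :: "'v ip_space \<Rightarrow> 'w ip_space \<Rightarrow> ('v \<Rightarrow> 'w) \<Rightarrow> real" where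
  "op_norm V W f = (SUP x \<in> {x \<in> carrier V. ip_norm V x \<le> 1}. ip_norm W (f x))"

definition invertible_op :: "complex set \<Rightarrow> 'v ip_space \<Rightarrow> ('v \<Rightarrow> 'v) \<Rightarrow> bool" where
  "invertible_op K V f \<longleftrightarrow>
    (\<exists>g\<in>bounded_ops K V V. \<forall>x\<in>carrier V. g (f x) = x \<and> f (g x) = x)"

abbreviation op_inv :: "'v ip_space \<Rightarrow> ('v \<Rightarrow> 'v) \<Rightarrow> 'v \<Rightarrow> 'v" where
  "op_inv V f \<equiv> inv_into (carrier V) f"

text \<open>Convergence along the infinite index set \<open>N\<close>; the values \<open>u n\<close> for \<open>n \<notin> N\<close> do not matter.\<close>

definition discretely_converges ::
  "(nat \<Rightarrow> 'w ip_space) \<Rightarrow> (nat \<Rightarrow> 'v \<Rightarrow> 'w) \<Rightarrow> nat set \<Rightarrow> (nat \<Rightarrow> 'w) \<Rightarrow> 'v \<Rightarrow> bool" where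
  "discretely_converges Xs p N u x \<longleftrightarrow>
    ((\<lambda>n. ip_norm (Xs n) (p n x \<ominus>\<^bsub>Xs n\<^esub> u n)) \<longlongrightarrow> 0) (inf sequentially (principal N))"

definition discretely_compact ::
  "'v ip_space \<Rightarrow> (nat \<Rightarrow> 'w ip_space) \<Rightarrow> (nat \<Rightarrow> 'v \<Rightarrow> 'w) \<Rightarrow> (nat \<Rightarrow> 'w) \<Rightarrow> bool" where
  "discretely_compact X Xs p u \<longleftrightarrow>
    (\<forall>N. infinite N \<longrightarrow>
      (\<exists>N'\<subseteq>N. infinite N' \<and> (\<exists>x\<in>carrier X. discretely_converges Xs p N' u x)))"

definition bounded_seq :: "(nat \<Rightarrow> 'w ip_space) \<Rightarrow> (nat \<Rightarrow> 'w) \<Rightarrow> bool" where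
  "bounded_seq Xs u \<longleftrightarrow>
    (\<forall>n. u n \<in> carrier (Xs n)) \<and> (\<exists>C. \<forall>n. ip_norm (Xs n) (u n) \<le> C)"

definition compact_op_seq ::
  "'v ip_space \<Rightarrow> (nat \<Rightarrow> 'w ip_space) \<Rightarrow> (nat \<Rightarrow> 'v \<Rightarrow> 'w) \<Rightarrow> (nat \<Rightarrow> 'w \<Rightarrow> 'w) \<Rightarrow> bool" where
  "compact_op_seq X Xs p F \<longleftrightarrow>
    (\<forall>u. bounded_seq Xs u \<longrightarrow> discretely_compact X Xs p (\<lambda>n. F n (u n)))"

definition regular_op_seq ::
  "'v ip_space \<Rightarrow> (nat \<Rightarrow> 'w ip_space) \<Rightarrow> (nat \<Rightarrow> 'v \<Rightarrow> 'w) \<Rightarrow> (nat \<Rightarrow> 'w \<Rightarrow> 'w) \<Rightarrow> bool" where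
  "regular_op_seq X Xs p F \<longleftrightarrow>
    (\<forall>u. bounded_seq Xs u \<longrightarrow> discretely_compact X Xs p (\<lambda>n. F n (u n)) \<longrightarrow>
      discretely_compact X Xs p u)"

end

theory Submission
  imports Defs
begin

text \<open>
  Let \<open>v\<^sub>n = T\<^sub>n\<^sup>-\<^sup>1 u\<^sub>n\<close>, so that \<open>A\<^sub>n u\<^sub>n = B\<^sub>n v\<^sub>n + K\<^sub>n v\<^sub>n\<close>.  Along a subsequence \<open>A\<^sub>n u\<^sub>n\<close>
  and \<open>K\<^sub>n v\<^sub>n\<close> converge, hence so does \<open>B\<^sub>n v\<^sub>n\<close>, say to \<open>B v\<close>.  The uniform bound on \<open>B\<^sub>n\<^sup>-\<^sup>1\<close> together
  with the consistency of \<open>B\<^sub>n\<close> with \<open>B\<close> gives \<open>v\<^sub>n \<rightarrow> v\<close>, and the uniform bound on \<open>T\<^sub>n\<close> together with its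
  consistency with \<open>T\<close> gives \<open>u\<^sub>n = T\<^sub>n v\<^sub>n \<rightarrow> T v\<close>.
\<close>

section \<open>Norm estimates in an inner product space with explicit carrier\<close>

context inner_product_space
begin

text \<open>Both admissible scalar sets contain the reals. The arguments below scale only by real
  numbers, so they need no distinction between the real and the complex case.\<close>

lemma of_real_scalar: "complex_of_real t \<in> K"
  using scalars by auto

lemma smult_in_carrier: "\<lbrakk>c \<in> K; x \<in> carrier V\<rbrakk> \<Longrightarrow> c \<odot>\<^bsub>V\<^esub> x \<in> carrier V"
  using smult_closed by (simp add: scalar_ring_def)

lemma ip_zero_left: "y \<in> carrier V \<Longrightarrow> ip V \<zero>\<^bsub>V\<^esub> y = 0"
  using ip_add_left[of "\<zero>\<^bsub>V\<^esub>" "\<zero>\<^bsub>V\<^esub>" y] by simp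

lemma ip_minus_left:
  assumes "x \<in> carrier V" "y \<in> carrier V"
  shows "ip V (\<ominus>\<^bsub>V\<^esub> x) y = - ip V x y"
  using ip_add_left[of "\<ominus>\<^bsub>V\<^esub> x" x y] assms
  by (simp add: M.l_neg ip_zero_left eq_neg_iff_add_eq_0)

lemma ip_nonneg: "x \<in> carrier V \<Longrightarrow> 0 \<le> Re (ip V x x)"
  using ip_pos[of x] ip_zero_left[of x] by (cases "x = \<zero>\<^bsub>V\<^esub>") auto

lemma ip_norm_nonneg: "x \<in> carrier V \<Longrightarrow> 0 \<le> ip_norm V x"
  by (simp add: ip_norm_def ip_nonneg)

lemma ip_norm_square: "x \<in> carrier V \<Longrightarrow> (ip_norm V x)\<^sup>2 = Re (ip V x x)"
  by (simp add: ip_norm_def ip_nonneg)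

lemma ip_norm_uminus:
  assumes "x \<in> carrier V"
  shows "ip_norm V (\<ominus>\<^bsub>V\<^esub> x) = ip_norm V x"
proof -
  have "ip V (\<ominus>\<^bsub>V\<^esub> x) (\<ominus>\<^bsub>V\<^esub> x) = - cnj (ip V (\<ominus>\<^bsub>V\<^esub> x) x)"
    using assms ip_minus_left ip_cnj[of "\<ominus>\<^bsub>V\<^esub> x" x] by simp
  then show ?thesis
    using assms ip_minus_left by (simp add: ip_norm_def)
qed

lemma ip_norm_smult_real:
  assumes "x \<in> carrier V"
  shows "ip_norm V (complex_of_real t \<odot>\<^bsub>V\<^esub> x) = \<bar>t\<bar> * ip_norm V x"
proof -
  have c: "complex_of_real t \<odot>\<^bsub>V\<^esub> x \<in> carrier V"
    using assms of_real_scalar smult_in_carrier by blast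
  have "ip V (complex_of_real t \<odot>\<^bsub>V\<^esub> x) (complex_of_real t \<odot>\<^bsub>V\<^esub> x)
      = t * cnj (ip V (complex_of_real t \<odot>\<^bsub>V\<^esub> x) x)"
    using ip_smult_left[OF of_real_scalar assms c] ip_cnj[OF c assms] by simp
  also have "\<dots> = t * (t * cnj (ip V x x))"
    using ip_smult_left[OF of_real_scalar assms assms] by simp
  finally have "Re (ip V (complex_of_real t \<odot>\<^bsub>V\<^esub> x) (complex_of_real t \<odot>\<^bsub>V\<^esub> x))
      = t\<^sup>2 * Re (ip V x x)"
    by (simp add: power2_eq_square)
  then show ?thesis
    by (simp add: ip_norm_def real_sqrt_mult)
qed

text \<open>The two cross terms are complex conjugates of each other, so their real parts agree and
  add up to the doubled term.\<close>

lemma Re_ip_add: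
  assumes "x \<in> carrier V" "y \<in> carrier V"
  shows "Re (ip V (x \<oplus>\<^bsub>V\<^esub> y) (x \<oplus>\<^bsub>V\<^esub> y)) = Re (ip V x x) + 2 * Re (ip V x y) + Re (ip V y y)"
proof -
  have "ip V (x \<oplus>\<^bsub>V\<^esub> y) (x \<oplus>\<^bsub>V\<^esub> y) = ip V x (x \<oplus>\<^bsub>V\<^esub> y) + ip V y (x \<oplus>\<^bsub>V\<^esub> y)"
    using assms ip_add_left by simp
  also have "\<dots> = cnj (ip V (x \<oplus>\<^bsub>V\<^esub> y) x) + cnj (ip V (x \<oplus>\<^bsub>V\<^esub> y) y)"
    using assms ip_cnj[of "x \<oplus>\<^bsub>V\<^esub> y" x] ip_cnj[of "x \<oplus>\<^bsub>V\<^esub> y" y] by simp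
  finally show ?thesis
    using assms ip_add_left ip_cnj[of x y] by simp
qed

text \<open>The quadratic \<open>Re (ip V (x + t y) (x + t y))\<close> in the real variable
  \<open>t\<close> is nonnegative, in particular at its minimum. The one-sided bound on the real
  part is what the triangle inequality uses.\<close>

lemma Cauchy_Schwarz_Re:
  assumes x: "x \<in> carrier V" and y: "y \<in> carrier V"
  shows "Re (ip V x y) \<le> ip_norm V x * ip_norm V y"
proof (cases "y = \<zero>\<^bsub>V\<^esub>")
  case True
  then show ?thesis
    using ip_cnj[OF y x] ip_zero_left[OF x] ip_norm_nonneg x y by simp
next
  case False
  define a b c where "a = Re (ip V x x)" and "b = Re (ip V x y)" and "c = Re (ip V y y)"
  \<comment> \<open>This is the minimiser of \<open>a + 2 * (t * b) + t\<^sup>2 * c\<close>; the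
    minimum is \<open>a - b\<^sup>2 / c\<close>.\<close>
  define t where "t = - b / c"
  have c: "c > 0"
    using ip_pos y False c_def by simp
  let ?z = "complex_of_real t \<odot>\<^bsub>V\<^esub> y"
  have z: "?z \<in> carrier V"
    using y of_real_scalar smult_in_carrier by blast
  have "Re (ip V x ?z) = t * b"
    using ip_cnj[OF z x] ip_smult_left[OF of_real_scalar y x, of t] ip_cnj[OF x y]
    by (simp add: b_def)
  moreover have "Re (ip V ?z ?z) = t\<^sup>2 * c"
    using ip_norm_square[OF z] ip_norm_smult_real[OF y, of t] ip_norm_square[OF y]
    by (simp add: power_mult_distrib c_def)
  ultimately have "0 \<le> a + 2 * (t * b) + t\<^sup>2 * c"
    using Re_ip_add[OF x z] ip_nonneg[of "x \<oplus>\<^bsub>V\<^esub> ?z"] x z by (simp add: a_def)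
  also have "\<dots> = a - b\<^sup>2 / c"
    using c by (simp add: t_def power2_eq_square field_simps)
  finally have "b\<^sup>2 \<le> a * c"
    using c by (simp add: field_simps)
  then have "b\<^sup>2 \<le> (ip_norm V x * ip_norm V y)\<^sup>2"
    using x y by (simp add: power_mult_distrib ip_norm_square a_def c_def)
  then show ?thesis
    unfolding b_def using ip_norm_nonneg x y by (meson mult_nonneg_nonneg power2_le_imp_le)
qed

lemma ip_norm_triangle:
  assumes "x \<in> carrier V" "y \<in> carrier V"
  shows "ip_norm V (x \<oplus>\<^bsub>V\<^esub> y) \<le> ip_norm V x + ip_norm V y"
proof (rule power2_le_imp_le)
  show "(ip_norm V (x \<oplus>\<^bsub>V\<^esub> y))\<^sup>2 \<le> (ip_norm V x + ip_norm V y)\<^sup>2"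
    using Cauchy_Schwarz_Re[OF assms] Re_ip_add[OF assms] assms
    by (simp add: power2_sum ip_norm_square)
qed (use assms ip_norm_nonneg in auto)

lemma ip_norm_minus_commute:
  assumes "x \<in> carrier V" "y \<in> carrier V"
  shows "ip_norm V (x \<ominus>\<^bsub>V\<^esub> y) = ip_norm V (y \<ominus>\<^bsub>V\<^esub> x)"
proof -
  have "y \<ominus>\<^bsub>V\<^esub> x = \<ominus>\<^bsub>V\<^esub> (x \<ominus>\<^bsub>V\<^esub> y)"
    using assms by (simp add: a_minus_def M.minus_add M.a_comm)
  then show ?thesis
    using assms ip_norm_uminus by simp
qed

lemma ip_norm_minus_triangle:
  assumes "x \<in> carrier V" "y \<in> carrier V" "z \<in> carrier V"
  shows "ip_norm V (x \<ominus>\<^bsub>V\<^esub> z) \<le> ip_norm V (x \<ominus>\<^bsub>V\<^esub> y) + ip_norm V (y \<ominus>\<^bsub>V\<^esub> z)"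
proof -
  have "x \<ominus>\<^bsub>V\<^esub> z = (x \<ominus>\<^bsub>V\<^esub> y) \<oplus>\<^bsub>V\<^esub> (y \<ominus>\<^bsub>V\<^esub> z)"
    using assms by (simp add: a_minus_def M.a_assoc M.r_neg1)
  then show ?thesis
    using assms ip_norm_triangle by simp
qed

text \<open>Regrouping the left side as \<open>(x - (z + w)) + (w - y)\<close> reduces it to the
  triangle inequality. The purpose is to pass from limits of a sum and of one summand to the limit
  of the other summand, with \<open>z\<close> and \<open>w\<close> standing for
  \<open>Bs n (v n)\<close> and \<open>Ks n (v n)\<close>.\<close>

lemma ip_norm_diff_diff:
  assumes "x \<in> carrier V" "y \<in> carrier V" "z \<in> carrier V" "w \<in> carrier V"
  shows "ip_norm V ((x \<ominus>\<^bsub>V\<^esub> y) \<ominus>\<^bsub>V\<^esub> z) \<le> ip_norm V (x \<ominus>\<^bsub>V\<^esub> (z \<oplus>\<^bsub>V\<^esub> w)) + ip_norm V (y \<ominus>\<^bsub>V\<^esub> w)"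
proof -
  have eq: "(x \<ominus>\<^bsub>V\<^esub> y) \<ominus>\<^bsub>V\<^esub> z = (x \<ominus>\<^bsub>V\<^esub> (z \<oplus>\<^bsub>V\<^esub> w)) \<oplus>\<^bsub>V\<^esub> (w \<ominus>\<^bsub>V\<^esub> y)"
  proof -
    have "(x \<ominus>\<^bsub>V\<^esub> (z \<oplus>\<^bsub>V\<^esub> w)) \<oplus>\<^bsub>V\<^esub> (w \<ominus>\<^bsub>V\<^esub> y)
        = x \<oplus>\<^bsub>V\<^esub> (\<ominus>\<^bsub>V\<^esub> z \<oplus>\<^bsub>V\<^esub> (\<ominus>\<^bsub>V\<^esub> w \<oplus>\<^bsub>V\<^esub> (w \<oplus>\<^bsub>V\<^esub> \<ominus>\<^bsub>V\<^esub> y)))"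
      using assms by (simp add: a_minus_def M.a_assoc M.minus_add)
    also have "\<dots> = x \<oplus>\<^bsub>V\<^esub> (\<ominus>\<^bsub>V\<^esub> z \<oplus>\<^bsub>V\<^esub> \<ominus>\<^bsub>V\<^esub> y)"
      using assms by (simp add: M.r_neg1)
    also have "\<dots> = (x \<ominus>\<^bsub>V\<^esub> y) \<ominus>\<^bsub>V\<^esub> z"
      using assms M.a_comm[of "\<ominus>\<^bsub>V\<^esub> z" "\<ominus>\<^bsub>V\<^esub> y"] by (simp add: a_minus_def M.a_assoc)
    finally show ?thesis
      by simp
  qed
  show ?thesis
    unfolding eq using assms ip_norm_triangle[of "x \<ominus>\<^bsub>V\<^esub> (z \<oplus>\<^bsub>V\<^esub> w)" "w \<ominus>\<^bsub>V\<^esub> y"]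
      ip_norm_minus_commute[of w y] by simp
qed

end

section \<open>Bounded operators, operator norms and inverses\<close>

lemma bounded_ops_closed: "\<lbrakk>f \<in> bounded_ops K V W; x \<in> carrier V\<rbrakk> \<Longrightarrow> f x \<in> carrier W"
  by (auto simp: bounded_ops_def)

lemma bounded_ops_minus:
  assumes "abelian_group V" "abelian_group W" "f \<in> bounded_ops K V W"
    and x: "x \<in> carrier V" and y: "y \<in> carrier V"
  shows "f (x \<ominus>\<^bsub>V\<^esub> y) = f x \<ominus>\<^bsub>W\<^esub> f y"
proof -
  interpret V: abelian_group V by fact
  interpret W: abelian_group W by fact
  have cl: "f z \<in> carrier W" if "z \<in> carrier V" for z
    using assms(3) that by (rule bounded_ops_closed)
  have "f x = f (x \<ominus>\<^bsub>V\<^esub> y \<oplus>\<^bsub>V\<^esub> y)"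
    using x y by (simp add: a_minus_def V.a_assoc V.l_neg)
  also have "\<dots> = f (x \<ominus>\<^bsub>V\<^esub> y) \<oplus>\<^bsub>W\<^esub> f y"
    using assms(3) x y by (simp add: bounded_ops_def)
  finally show ?thesis
    using x y cl by (simp add: a_minus_def W.a_assoc W.r_neg)
qed

text \<open>Scaling \<open>x\<close> to norm one puts it into the set over which the supremum in
  \<open>op_norm\<close> is taken.\<close>

lemma ip_norm_le_op_norm:
  assumes "inner_product_space K V" "inner_product_space K W"
    and f: "f \<in> bounded_ops K V W" and x: "x \<in> carrier V"
  shows "ip_norm W (f x) \<le> op_norm V W f * ip_norm V x"
proof -
  interpret V: inner_product_space K V by fact
  interpret W: inner_product_space K W by fact
  obtain M where M: "\<And>x. x \<in> carrier V \<Longrightarrow> ip_norm W (f x) \<le> M * ip_norm V x"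
    using f unfolding bounded_ops_def by blast
  \<comment> \<open>A real supremum dominates its set only if that set is bounded above. The
    absolute value appears because the sign of \<open>M\<close> is not known.\<close>
  have bdd: "bdd_above ((\<lambda>x. ip_norm W (f x)) ` {x \<in> carrier V. ip_norm V x \<le> 1})"
  proof (rule bdd_aboveI2)
    fix x assume "x \<in> {x \<in> carrier V. ip_norm V x \<le> 1}"
    then have x: "x \<in> carrier V" "ip_norm V x \<le> 1" by auto
    have "M * ip_norm V x \<le> \<bar>M\<bar> * 1"
      using x V.ip_norm_nonneg by (intro mult_mono) auto
    then show "ip_norm W (f x) \<le> \<bar>M\<bar>"
      using M[of x] x by simp
  qed
  show ?thesis
  proof (cases "ip_norm V x = 0")
    case True
    \<comment> \<open>Here scaling is impossible, but the bound with \<open>M\<close> already forces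
      the image to have norm at most zero.\<close>
    then show ?thesis using M[OF x] by simp
  next
    case False
    then have n: "ip_norm V x > 0"
      using V.ip_norm_nonneg[OF x] by simp
    define t where "t = 1 / ip_norm V x"
    have t: "t * ip_norm V x = 1" "t > 0"
      using n by (simp_all add: t_def)
    let ?c = "complex_of_real t"
    have "ip_norm V (?c \<odot>\<^bsub>V\<^esub> x) = 1"
      using V.ip_norm_smult_real[OF x] t by simp
    moreover have "?c \<odot>\<^bsub>V\<^esub> x \<in> carrier V"
      using V.smult_in_carrier V.of_real_scalar x by blast
    ultimately have "ip_norm W (f (?c \<odot>\<^bsub>V\<^esub> x)) \<le> op_norm V W f"
      unfolding op_norm_def by (intro cSUP_upper[OF _ bdd]) auto
    moreover have "f (?c \<odot>\<^bsub>V\<^esub> x) = ?c \<odot>\<^bsub>W\<^esub> f x"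
      using f x V.of_real_scalar by (simp add: bounded_ops_def)
    ultimately have "t * ip_norm W (f x) \<le> op_norm V W f"
      using W.ip_norm_smult_real[OF bounded_ops_closed[OF f x], of t] t by simp
    then show ?thesis
      using n by (simp add: t_def field_simps)
  qed
qed

lemma op_inv_eq:
  assumes "\<And>x. x \<in> carrier V \<Longrightarrow> g (f x) = x \<and> f (g x) = x"
    and "\<And>x. x \<in> carrier V \<Longrightarrow> g x \<in> carrier V" and "x \<in> carrier V"
  shows "op_inv V f x = g x"
  by (rule inv_into_f_eq) (use assms in \<open>auto intro: inj_on_inverseI\<close>)

text \<open>On the carrier, \<open>op_inv\<close> coincides with the two-sided inverse
  \<open>g\<close> supplied by \<open>invertible_op\<close>. Membership in
  \<open>bounded_ops\<close> depends only on values on the carrier, so it carries over from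
  \<open>g\<close>.\<close>

lemma invertible_op_inverse:
  assumes "inner_product_space K V" "invertible_op K V f"
  shows "op_inv V f \<in> bounded_ops K V V"
    and "x \<in> carrier V \<Longrightarrow> op_inv V f (f x) = x"
    and "x \<in> carrier V \<Longrightarrow> f (op_inv V f x) = x"
proof -
  interpret inner_product_space K V by fact
  obtain g where g: "g \<in> bounded_ops K V V" "\<And>x. x \<in> carrier V \<Longrightarrow> g (f x) = x \<and> f (g x) = x"
    using assms(2) by (auto simp: invertible_op_def)
  have eq: "op_inv V f x = g x" if "x \<in> carrier V" for x
    by (rule op_inv_eq[OF g(2) bounded_ops_closed[OF g(1)] that])
  show "op_inv V f \<in> bounded_ops K V V"
    using g(1) eq smult_in_carrier by (auto simp: bounded_ops_def Pi_iff)
  show "op_inv V f (f x) = x" if "x \<in> carrier V"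
    using g(2) that by (intro inv_into_f_f) (auto intro: inj_on_inverseI)
  show "f (op_inv V f x) = x" if "x \<in> carrier V"
    using g(2) eq that by simp
qed

section \<open>Regularity of the operator sequence\<close>

theorem theorem3:
  fixes K :: "complex set"
    and X :: "'v ip_space"
    and Xs :: "nat \<Rightarrow> 'w ip_space"
    and p :: "nat \<Rightarrow> 'v \<Rightarrow> 'w"
    and As Ts Bs Ks :: "nat \<Rightarrow> 'w \<Rightarrow> 'w"
    and B T :: "'v \<Rightarrow> 'v"
    and C :: real
  assumes "hilbert_space K X"
    and "\<And>n. hilbert_space K (Xs n)"
    and "\<And>n. finite_dimensional K (Xs n)"
    and "\<And>n. p n \<in> bounded_ops K X (Xs n)"
    and "\<And>u. u \<in> carrier X \<Longrightarrow> (\<lambda>n. ip_norm (Xs n) (p n u)) \<longlonglongrightarrow> ip_norm X u"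
    and "B \<in> bounded_ops K X X" and "T \<in> bounded_ops K X X"
    and "C > 0"
    and "\<And>n. As n \<in> bounded_ops K (Xs n) (Xs n)"
    and "\<And>n. Ts n \<in> bounded_ops K (Xs n) (Xs n)"
    and "\<And>n. Bs n \<in> bounded_ops K (Xs n) (Xs n)"
    and "\<And>n. Ks n \<in> bounded_ops K (Xs n) (Xs n)"
    and "\<And>n. invertible_op K (Xs n) (Ts n)"
    and "\<And>n. invertible_op K (Xs n) (Bs n)"
    and "\<And>n. op_norm (Xs n) (Xs n) (Ts n) \<le> C"
    and "\<And>n. op_norm (Xs n) (Xs n) (op_inv (Xs n) (Ts n)) \<le> C"
    and "\<And>n. op_norm (Xs n) (Xs n) (Bs n) \<le> C"
    and "\<And>n. op_norm (Xs n) (Xs n) (op_inv (Xs n) (Bs n)) \<le> C"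
    and "bij_betw B (carrier X) (carrier X)"
    and "compact_op_seq X Xs p Ks"
    and "\<And>u. u \<in> carrier X \<Longrightarrow>
          (\<lambda>n. ip_norm (Xs n) (Ts n (p n u) \<ominus>\<^bsub>Xs n\<^esub> p n (T u))) \<longlonglongrightarrow> 0"
    and "\<And>u. u \<in> carrier X \<Longrightarrow>
          (\<lambda>n. ip_norm (Xs n) (Bs n (p n u) \<ominus>\<^bsub>Xs n\<^esub> p n (B u))) \<longlonglongrightarrow> 0"
    and "\<And>n x. x \<in> carrier (Xs n) \<Longrightarrow> As n (Ts n x) = Bs n x \<oplus>\<^bsub>Xs n\<^esub> Ks n x"
  shows "regular_op_seq X Xs p As"
proof -
  interpret X: hilbert_space K X by fact
  interpret W: hilbert_space K "Xs n" for n by fact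
  note ips = W.inner_product_space_axioms
  note cl = bounded_ops_closed[OF assms(4)] bounded_ops_closed[OF assms(6)]
    bounded_ops_closed[OF assms(7)] bounded_ops_closed[OF assms(9)]
    bounded_ops_closed[OF assms(10)] bounded_ops_closed[OF assms(11)]
    bounded_ops_closed[OF assms(12)]
  \<comment> \<open>Turns the uniform operator norm bounds into pointwise ones; it is applied to
    \<open>Ts n\<close> and to the inverses of \<open>Ts n\<close> and \<open>Bs n\<close>.\<close>
  have bound: "ip_norm (Xs n) (f x) \<le> C * ip_norm (Xs n) x"
    if "f \<in> bounded_ops K (Xs n) (Xs n)" "op_norm (Xs n) (Xs n) f \<le> C" "x \<in> carrier (Xs n)" for n f x
    using ip_norm_le_op_norm[OF ips ips that(1,3)] mult_right_mono[OF that(2) W.ip_norm_nonneg[OF that(3)]]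
    by linarith
  show ?thesis
    unfolding regular_op_seq_def
  proof (intro allI impI)
    fix u assume u: "bounded_seq Xs u" and cpt: "discretely_compact X Xs p (\<lambda>n. As n (u n))"
    obtain D where uc: "\<And>n. u n \<in> carrier (Xs n)" and D: "\<And>n. ip_norm (Xs n) (u n) \<le> D"
      using u unfolding bounded_seq_def by blast
    define v where "v n = op_inv (Xs n) (Ts n) (u n)" for n
    note invT = invertible_op_inverse[OF ips assms(13)]
    note invB = invertible_op_inverse[OF ips assms(14)]
    have vc: "v n \<in> carrier (Xs n)" for n
      unfolding v_def by (rule bounded_ops_closed[OF invT(1) uc])
    have Tv: "Ts n (v n) = u n" for n
      unfolding v_def by (rule invT(3)[OF uc])
    have "ip_norm (Xs n) (v n) \<le> C * D" for n
    proof -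
      have "ip_norm (Xs n) (v n) \<le> C * ip_norm (Xs n) (u n)"
        unfolding v_def by (rule bound[OF invT(1) assms(16) uc])
      also have "\<dots> \<le> C * D"
        using D assms(8) by simp
      finally show ?thesis .
    qed
    then have "bounded_seq Xs v"
      using vc unfolding bounded_seq_def by blast
    then have cptK: "discretely_compact X Xs p (\<lambda>n. Ks n (v n))"
      using assms(20) by (simp add: compact_op_seq_def)
    have split: "As n (u n) = Bs n (v n) \<oplus>\<^bsub>Xs n\<^esub> Ks n (v n)" for n
      using assms(23)[OF vc] Tv by simp
    show "discretely_compact X Xs p u"
      unfolding discretely_compact_def
    proof (intro allI impI)
      fix N :: "nat set" assume "infinite N"
      then obtain N1 w where N1: "N1 \<subseteq> N" "infinite N1" and w: "w \<in> carrier X"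
        and limA: "discretely_converges Xs p N1 (\<lambda>n. As n (u n)) w"
        using cpt unfolding discretely_compact_def by meson
      \<comment> \<open>The second extraction starts from \<open>N1\<close> instead of
        \<open>N\<close>, so that both limits are available along \<open>N2\<close>.\<close>
      obtain N2 k where N2: "N2 \<subseteq> N1" "infinite N2" and k: "k \<in> carrier X"
        and limK: "discretely_converges Xs p N2 (\<lambda>n. Ks n (v n)) k"
        using cptK N1(2) unfolding discretely_compact_def by meson
      \<comment> \<open>The expected limit of \<open>Bs n (v n)\<close> is \<open>w - k\<close>;
        surjectivity of \<open>B\<close> yields the candidate limit \<open>z\<close> of
        \<open>v\<close>.\<close>
      have "w \<ominus>\<^bsub>X\<^esub> k \<in> B ` carrier X"
        using w k assms(19) by (simp add: bij_betw_def)
      then obtain z where z: "z \<in> carrier X" and Bz: "B z = w \<ominus>\<^bsub>X\<^esub> k"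
        by auto
      let ?F = "inf sequentially (principal N2)"
      have limA': "((\<lambda>n. ip_norm (Xs n) (p n w \<ominus>\<^bsub>Xs n\<^esub> As n (u n))) \<longlongrightarrow> 0) ?F"
        using N2(1) by (intro tendsto_mono[OF inf_mono limA[unfolded discretely_converges_def]]) auto
      have limK': "((\<lambda>n. ip_norm (Xs n) (p n k \<ominus>\<^bsub>Xs n\<^esub> Ks n (v n))) \<longlongrightarrow> 0) ?F"
        using limK unfolding discretely_converges_def .
      have limB: "((\<lambda>n. ip_norm (Xs n) (Bs n (p n z) \<ominus>\<^bsub>Xs n\<^esub> p n (B z))) \<longlongrightarrow> 0) ?F"
        and limT: "((\<lambda>n. ip_norm (Xs n) (Ts n (p n z) \<ominus>\<^bsub>Xs n\<^esub> p n (T z))) \<longlongrightarrow> 0) ?F"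
        by (rule tendsto_mono[OF inf_le1 assms(22)[OF z]], rule tendsto_mono[OF inf_le1 assms(21)[OF z]])
      \<comment> \<open>An error bound for \<open>v n\<close> against \<open>p n z\<close>: the
        consistency error of \<open>Bs n\<close> at \<open>z\<close> plus the errors of the two
        extracted limits, amplified by the bound \<open>C\<close> on the inverse of
        \<open>Bs n\<close>.\<close>
      let ?b = "\<lambda>n. C * (ip_norm (Xs n) (Bs n (p n z) \<ominus>\<^bsub>Xs n\<^esub> p n (B z))
          + (ip_norm (Xs n) (p n w \<ominus>\<^bsub>Xs n\<^esub> As n (u n)) + ip_norm (Xs n) (p n k \<ominus>\<^bsub>Xs n\<^esub> Ks n (v n))))"
      have v_est: "ip_norm (Xs n) (p n z \<ominus>\<^bsub>Xs n\<^esub> v n) \<le> ?b n" for n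
      proof -
        have d: "p n z \<ominus>\<^bsub>Xs n\<^esub> v n \<in> carrier (Xs n)"
          using z vc cl by simp
        \<comment> \<open>Stability: \<open>p n z - v n\<close> is recovered from its image under
          \<open>Bs n\<close> by the inverse, at the cost of a factor \<open>C\<close>.\<close>
        have "ip_norm (Xs n) (p n z \<ominus>\<^bsub>Xs n\<^esub> v n)
            \<le> C * ip_norm (Xs n) (Bs n (p n z \<ominus>\<^bsub>Xs n\<^esub> v n))"
          using bound[OF invB(1) assms(18) bounded_ops_closed[OF assms(11) d]] unfolding invB(2)[OF d] .
        also have "Bs n (p n z \<ominus>\<^bsub>Xs n\<^esub> v n) = Bs n (p n z) \<ominus>\<^bsub>Xs n\<^esub> Bs n (v n)"
          using bounded_ops_minus[OF W.abelian_group_axioms W.abelian_group_axioms assms(11)] z vc cl by simp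
        also have "ip_norm (Xs n) \<dots> \<le> ip_norm (Xs n) (Bs n (p n z) \<ominus>\<^bsub>Xs n\<^esub> p n (B z))
            + ip_norm (Xs n) (p n (B z) \<ominus>\<^bsub>Xs n\<^esub> Bs n (v n))"
          using z vc cl by (intro W.ip_norm_minus_triangle) auto
        \<comment> \<open>The choice of \<open>z\<close> and the linearity of \<open>p n\<close>
          bring in the limits \<open>w\<close> and \<open>k\<close>.\<close>
        also have "p n (B z) = p n w \<ominus>\<^bsub>Xs n\<^esub> p n k"
          unfolding Bz using bounded_ops_minus[OF X.abelian_group_axioms W.abelian_group_axioms assms(4)] w k
          by simp
        also have "ip_norm (Xs n) (p n w \<ominus>\<^bsub>Xs n\<^esub> p n k \<ominus>\<^bsub>Xs n\<^esub> Bs n (v n))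
            \<le> ip_norm (Xs n) (p n w \<ominus>\<^bsub>Xs n\<^esub> As n (u n)) + ip_norm (Xs n) (p n k \<ominus>\<^bsub>Xs n\<^esub> Ks n (v n))"
          unfolding split using w k vc cl by (intro W.ip_norm_diff_diff) auto
        finally show ?thesis
          using assms(8) \<open>p n (B z) = _\<close> by simp
      qed
      \<comment> \<open>Since \<open>u n = Ts n (v n)\<close>, inserting \<open>Ts n (p n z)\<close>
        separates the consistency error of \<open>Ts n\<close> from the error of \<open>v n\<close>,
        which \<open>Ts n\<close> enlarges by at most \<open>C\<close>.\<close>
      have u_est: "ip_norm (Xs n) (p n (T z) \<ominus>\<^bsub>Xs n\<^esub> u n)
          \<le> ip_norm (Xs n) (Ts n (p n z) \<ominus>\<^bsub>Xs n\<^esub> p n (T z)) + C * ?b n" for n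
      proof -
        have "ip_norm (Xs n) (p n (T z) \<ominus>\<^bsub>Xs n\<^esub> u n)
            \<le> ip_norm (Xs n) (p n (T z) \<ominus>\<^bsub>Xs n\<^esub> Ts n (p n z)) + ip_norm (Xs n) (Ts n (p n z) \<ominus>\<^bsub>Xs n\<^esub> u n)"
          using z uc cl by (intro W.ip_norm_minus_triangle) auto
        moreover have "ip_norm (Xs n) (p n (T z) \<ominus>\<^bsub>Xs n\<^esub> Ts n (p n z))
            = ip_norm (Xs n) (Ts n (p n z) \<ominus>\<^bsub>Xs n\<^esub> p n (T z))"
          using z cl by (intro W.ip_norm_minus_commute) auto
        moreover have "Ts n (p n z) \<ominus>\<^bsub>Xs n\<^esub> u n = Ts n (p n z \<ominus>\<^bsub>Xs n\<^esub> v n)"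
          using bounded_ops_minus[OF W.abelian_group_axioms W.abelian_group_axioms assms(10)] z vc cl Tv by simp
        moreover have "ip_norm (Xs n) (Ts n (p n z \<ominus>\<^bsub>Xs n\<^esub> v n)) \<le> C * ip_norm (Xs n) (p n z \<ominus>\<^bsub>Xs n\<^esub> v n)"
          using z vc cl by (intro bound[OF assms(10,15)]) auto
        moreover have "\<dots> \<le> C * ?b n"
          using v_est assms(8) by (intro mult_left_mono) auto
        ultimately show ?thesis
          by simp
      qed
      \<comment> \<open>The limit is left unevaluated so that its shape matches the sums and
        products of the bound term by term.\<close>
      have "((\<lambda>n. ip_norm (Xs n) (Ts n (p n z) \<ominus>\<^bsub>Xs n\<^esub> p n (T z)) + C * ?b n)
          \<longlongrightarrow> 0 + C * (C * (0 + (0 + 0)))) ?F"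
        by (intro tendsto_add tendsto_mult_left limA' limB limK' limT)
      then have lim: "((\<lambda>n. ip_norm (Xs n) (Ts n (p n z) \<ominus>\<^bsub>Xs n\<^esub> p n (T z)) + C * ?b n) \<longlongrightarrow> 0) ?F"
        by simp
      have nonneg: "0 \<le> ip_norm (Xs n) (p n (T z) \<ominus>\<^bsub>Xs n\<^esub> u n)" for n
        using z uc cl by (intro W.ip_norm_nonneg) simp
      have "((\<lambda>n. ip_norm (Xs n) (p n (T z) \<ominus>\<^bsub>Xs n\<^esub> u n)) \<longlongrightarrow> 0) ?F"
        by (rule tendsto_sandwich[OF always_eventually always_eventually tendsto_const lim])
          (use nonneg u_est in blast)+
      then show "\<exists>N'\<subseteq>N. infinite N' \<and> (\<exists>x\<in>carrier X. discretely_converges Xs p N' u x)"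
        using N1(1) N2 cl(3)[OF z] unfolding discretely_converges_def by (meson order_trans)
    qed
  qed
qed

end
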